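(* Let $m,n\ge1$ be integers and let $\vec p=(p_1,\ldots,p_m)$, $\vec q=(q_1,\ldots,q_m)$ with $1\le p_i,q_i<\infty$ for $1\le i\le m$. Let $T$ be a linear operator which is bounded from $L^{\vec p}(\mathbb R^{mn})$ to $L^{\vec q}(\mathbb R^{mn})$ and commutes with translations. Then $q_i\ge p_i$ for all $1\le i\le m$.
   Context: For $\vec p=(p_1,\ldots,p_m)$, the mixed-norm Lebesgue space $L^{\vec p}(\mathbb R^{mn})$ consists of all measurable $f(x_1,\ldots,x_m)$, $x_i\in\mathbb R^n$, with $\|f\|_{L^{\vec p}}:=\big\|\,\|f\|_{L^{p_1}_{x_1}}\cdots\big\|_{L^{p_m}_{x_m}}<\infty$ (the norm in $x_1$ is innermost, the norm in $x_m$ outermost). $T$ commutes with translations if $T(f(\cdot-z))=(Tf)(\cdot-z)$ for every $f\in L^{\vec p}$ and $z\in\mathbb R^{mn}$.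
   Formalization: The operator T is additionally assumed to be nonzero; as printed the claim fails for T = 0, which is linear, bounded from any mixed-norm space to any other and commutes with translations, even when some q_i < p_i. *)

theory Defs
  imports "HOL-Analysis.Analysis"
begin

text \<open>
  A point \<open>x = (x\<^sub>1, \<dots>, x\<^sub>m)\<close> of the \<open>mn\<close>-dimensional space is an element of
  \<open>(real ^ 'n) ^ 'm\<close>, with blocks \<open>x $ i\<close> in \<open>real ^ 'n\<close>.  The order of the blocks matters for the
  mixed norm, so \<open>'m\<close> is a finite linearly ordered type (which stands for \<open>1 < \<dots> < m\<close>).
\<close>

definition replace_block ::
  "'m::finite \<Rightarrow> real ^ 'n \<Rightarrow> real ^ 'n ^ 'm \<Rightarrow> real ^ 'n ^ 'm"
  where "replace_block i y x = (\<chi> j. if j = i then y else x $ j)"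

text \<open>Real powers on \<open>[0, \<infinity>]\<close>; only used with a positive exponent, hence \<open>\<infinity>\<close> is sent to \<open>\<infinity>\<close>.\<close>

definition ennreal_powr :: "ennreal \<Rightarrow> real \<Rightarrow> ennreal"
  where "ennreal_powr a r = (if a = top then top else ennreal (enn2real a powr r))"

text \<open>
  The \<open>L\<^sup>r\<close> norm in the \<open>i\<close>-th block alone.  The result is again written as a function of all
  blocks, but it does not depend on block \<open>i\<close>.
\<close>

definition block_norm ::
  "real \<Rightarrow> 'm::finite \<Rightarrow> (real ^ 'n ^ 'm \<Rightarrow> ennreal) \<Rightarrow> real ^ 'n ^ 'm \<Rightarrow> ennreal"
  where "block_norm r i g x =
    ennreal_powr (\<integral>\<^sup>+ y. ennreal_powr (g (replace_block i y x)) r \<partial>lborel) (1 / r)"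

text \<open>
  The blocks are processed in increasing order, so the first block is innermost and the last one
  outermost.  Once all the norms are taken the function is constant; \<open>0\<close> is an arbitrary point
  at which it is evaluated.
\<close>

definition mixed_norm ::
  "('m \<Rightarrow> real) \<Rightarrow> (real ^ 'n ^ 'm::{finite,linorder} \<Rightarrow> complex) \<Rightarrow> ennreal"
  where "mixed_norm p f =
    fold (\<lambda>i. block_norm (p i) i) (sorted_list_of_set UNIV) (\<lambda>x. ennreal (norm (f x))) 0"

text \<open>
  Elements are representatives, and identification almost everywhere is made explicit below.
  Every class of Lebesgue measurable functions contains a Borel measurable one, and for Borel
  functions all the iterated integrands in the mixed norm are measurable.
\<close>

definition mixed_Lp ::
  "('m \<Rightarrow> real) \<Rightarrow> (real ^ 'n ^ 'm::{finite,linorder} \<Rightarrow> complex) set"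
  where "mixed_Lp p = {f \<in> borel_measurable lborel. mixed_norm p f < top}"

definition translate :: "'a::ab_group_add \<Rightarrow> ('a \<Rightarrow> 'b) \<Rightarrow> 'a \<Rightarrow> 'b"
  where "translate z f = (\<lambda>x. f (x - z))"

text \<open>
  The first two conditions say that \<open>T\<close> induces a map between the spaces of classes modulo
  equality almost everywhere.
\<close>

definition bounded_linear_mixed_Lp ::
  "('m \<Rightarrow> real) \<Rightarrow> ('m \<Rightarrow> real) \<Rightarrow>
    ((real ^ 'n ^ 'm::{finite,linorder} \<Rightarrow> complex) \<Rightarrow> real ^ 'n ^ 'm::{finite,linorder} \<Rightarrow> complex) \<Rightarrow> bool"
  where "bounded_linear_mixed_Lp p q T \<longleftrightarrow>
    (\<forall>f \<in> mixed_Lp p. T f \<in> mixed_Lp q) \<and>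
    (\<forall>f \<in> mixed_Lp p. \<forall>g \<in> mixed_Lp p.
       (AE x in lborel. f x = g x) \<longrightarrow> (AE x in lborel. T f x = T g x)) \<and>
    (\<forall>f \<in> mixed_Lp p. \<forall>g \<in> mixed_Lp p.
       AE x in lborel. T (\<lambda>y. f y + g y) x = T f x + T g x) \<and>
    (\<forall>f \<in> mixed_Lp p. \<forall>c. AE x in lborel. T (\<lambda>y. c * f y) x = c * T f x) \<and>
    (\<exists>C::real. \<forall>f \<in> mixed_Lp p. mixed_norm q (T f) \<le> ennreal C * mixed_norm p f)"

definition commutes_with_translations ::
  "('m \<Rightarrow> real) \<Rightarrow>
    ((real ^ 'n ^ 'm::{finite,linorder} \<Rightarrow> complex) \<Rightarrow> real ^ 'n ^ 'm::{finite,linorder} \<Rightarrow> complex) \<Rightarrow> bool"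
  where "commutes_with_translations p T \<longleftrightarrow>
    (\<forall>f \<in> mixed_Lp p. \<forall>z. AE x in lborel. T (translate z f) x = translate z (T f) x)"

end

theory Submission
  imports Defs
begin

text \<open>
  Hoermander's argument.  Add \<open>N\<close> translates of \<open>f\<close>, all in the direction of block \<open>i\<close>.  If \<open>f\<close> is
  supported in a slab \<open>norm (x $ i) \<le> R\<close> and the shifts are more than \<open>2 * R\<close> apart, the norms in the
  blocks before \<open>i\<close> never mix different translates, so the sum has norm exactly
  \<open>N powr (1 / p i)\<close> times that of \<open>f\<close>.  For general \<open>f\<close> this remains true up to a factor independent
  of \<open>N\<close> in the limit of infinite separation, since the part of \<open>f\<close> outside the slab has small norm.
  Applying this to \<open>f\<close> and to \<open>T f\<close> gives \<open>N powr (1 / q i) \<le> const * N powr (1 / p i)\<close> for all \<open>N\<close>.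
  As constants do not matter, Minkowski's inequality is replaced by a quasi-triangle inequality that
  loses a factor 4 per block.
\<close>

section \<open>Real powers on \<open>[0, \<infinity>]\<close>\<close>

lemma ennreal_powr_ennreal: "0 \<le> a \<Longrightarrow> ennreal_powr (ennreal a) r = ennreal (a powr r)"
  by (simp add: ennreal_powr_def)

lemma ennreal_powr_0 [simp]: "ennreal_powr 0 r = 0"
  by (simp add: ennreal_powr_def)

lemma ennreal_powr_eq_0_iff: "ennreal_powr a r = 0 \<longleftrightarrow> a = 0"
  by (cases a) (auto simp: ennreal_powr_def)

lemma ennreal_powr_eq_top_iff: "ennreal_powr a r = top \<longleftrightarrow> a = top"
  by (auto simp: ennreal_powr_def)

lemma ennreal_powr_mono: "0 \<le> r \<Longrightarrow> a \<le> b \<Longrightarrow> ennreal_powr a r \<le> ennreal_powr b r"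
  by (cases a; cases b) (auto simp: ennreal_powr_def powr_mono2 top_unique)

lemma ennreal_powr_cmult:
  assumes "0 \<le> c"
  shows "ennreal_powr (ennreal c * a) r = ennreal (c powr r) * ennreal_powr a r"
proof (cases a)
  case (real b)
  then show ?thesis
    using assms by (simp add: ennreal_mult'[symmetric] ennreal_powr_ennreal powr_mult)
next
  case top
  then show ?thesis
    \<comment> \<open>For \<open>c = 0\<close> both sides are \<open>0\<close>, because
      \<open>0 * top = 0\<close> and \<open>0 powr r = 0\<close>.\<close>
    using assms by (cases "c = 0") (simp_all add: ennreal_powr_def ennreal_mult_top)
qed

text \<open>The crude bound \<open>a + b \<le> 2 * max a b\<close> avoids convexity, so it serves
  both for an exponent \<open>r \<ge> 1\<close> and for the root \<open>1 / r\<close>.\<close>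

lemma ennreal_powr_add_le:
  assumes "0 \<le> r"
  shows "ennreal_powr (a + b) r \<le> ennreal (2 powr r) * (ennreal_powr a r + ennreal_powr b r)"
proof -
  have "a + b \<le> 2 * max a b"
    unfolding mult_2 by (intro add_mono) auto
  then have "ennreal_powr (a + b) r \<le> ennreal_powr (ennreal 2 * max a b) r"
    using assms by (intro ennreal_powr_mono) auto
  also have "\<dots> = ennreal (2 powr r) * ennreal_powr (max a b) r"
    by (rule ennreal_powr_cmult) simp
  also have "\<dots> \<le> ennreal (2 powr r) * (ennreal_powr a r + ennreal_powr b r)"
    by (intro mult_left_mono) (auto simp: max_def)
  finally show ?thesis .
qed

lemma borel_measurable_ennreal_powr [measurable]:
  assumes [measurable]: "f \<in> borel_measurable M"
  shows "(\<lambda>x. ennreal_powr (f x) r) \<in> borel_measurable M"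
  unfolding ennreal_powr_def by measurable

text \<open>A family tending to \<open>0\<close> is eventually finite, which reduces the claim to
  real powers.\<close>

lemma tendsto_ennreal_powr_0:
  assumes "(f \<longlongrightarrow> 0) F" "0 < r"
  shows "((\<lambda>x. ennreal_powr (f x) r) \<longlongrightarrow> 0) F"
proof -
  have fin: "\<forall>\<^sub>F x in F. f x < top"
    using assms(1) by (rule order_tendstoD) simp
  have "((\<lambda>x. enn2real (f x)) \<longlongrightarrow> enn2real 0) F"
    using assms(1) by (intro tendsto_enn2real) (auto)
  then have "((\<lambda>x. enn2real (f x) powr r) \<longlongrightarrow> 0) F"
    using assms(2) by (intro tendsto_zero_powrI) auto
  then have "((\<lambda>x. ennreal (enn2real (f x) powr r)) \<longlongrightarrow> ennreal 0) F"
    by (rule tendsto_ennrealI)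
  moreover have "\<forall>\<^sub>F x in F. ennreal (enn2real (f x) powr r) = ennreal_powr (f x) r"
    using fin by eventually_elim (simp add: ennreal_powr_def)
  ultimately show ?thesis
    by (simp add: tendsto_cong)
qed

section \<open>Replacing one block, and translations along it\<close>

lemma replace_block_nth: "replace_block i y x $ j = (if j = i then y else x $ j)"
  by (simp add: replace_block_def)

lemma replace_block_eq_add_axis: "replace_block i (x $ i + y) x = x + axis i y"
  by (simp add: vec_eq_iff replace_block_nth axis_def)

lemma replace_block_diff:
  "replace_block i y x - z = replace_block i (y - z $ i) (x - z)"
  by (simp add: vec_eq_iff replace_block_nth)

lemma continuous_on_axis: "continuous_on UNIV (\<lambda>y::real^'n. axis i y :: real^'n^'m::finite)"
proof -
  have "linear (\<lambda>y::real^'n. axis i y :: real^'n^'m)"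
    by (rule linearI) (simp_all add: vec_eq_iff axis_def)
  then show ?thesis
    by (rule linear_continuous_on[OF linear_linear[THEN iffD2]])
qed

lemma borel_measurable_axis [measurable]:
  "(\<lambda>y::real^'n. axis i y :: real^'n^'m::finite) \<in> borel_measurable borel"
  by (rule borel_measurable_continuous_onI[OF continuous_on_axis])

lemma borel_measurable_block [measurable]:
  "(\<lambda>x::real^'n^'m::finite. x $ i) \<in> borel_measurable borel"
  by (intro borel_measurable_continuous_onI continuous_intros)

lemma replace_block_measurable [measurable (raw)]:
  fixes f :: "'a \<Rightarrow> real^'n" and g :: "'a \<Rightarrow> real^'n^'m::finite"
  assumes [measurable]: "f \<in> borel_measurable M" "g \<in> borel_measurable M"
  shows "(\<lambda>w. replace_block i (f w) (g w)) \<in> borel_measurable M"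
proof -
  have "(\<lambda>w. replace_block i (f w) (g w)) = (\<lambda>w. g w + axis i (f w - g w $ i))"
    by (simp add: fun_eq_iff vec_eq_iff replace_block_nth axis_def)
  then show ?thesis
    by simp
qed

lemma nn_integral_lborel_shift:
  fixes f :: "'a::euclidean_space \<Rightarrow> ennreal"
  assumes [measurable]: "f \<in> borel_measurable borel"
  shows "(\<integral>\<^sup>+x. f (c + x) \<partial>lborel) = (\<integral>\<^sup>+x. f x \<partial>lborel)"
proof -
  have "(\<integral>\<^sup>+x. f x \<partial>lborel) = (\<integral>\<^sup>+x. f x \<partial>distr lborel borel ((+) c))"
    by (simp add: lborel_distr_plus)
  also have "\<dots> = (\<integral>\<^sup>+x. f (c + x) \<partial>lborel)"
    by (rule nn_integral_distr) auto
  finally show ?thesis ..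
qed

text \<open>
  A Fubini theorem that does not split the space into a product: moving along block \<open>i\<close> is a
  translation, so Tonelli's theorem and translation invariance suffice.
\<close>

lemma AE_block_iff:
  fixes P :: "real^'n^'m::finite \<Rightarrow> bool"
  assumes [measurable]: "Measurable.pred borel P"
  shows "(AE x in lborel. AE y in lborel. P (replace_block i y x)) \<longleftrightarrow> (AE x in lborel. P x)"
proof -
  \<comment> \<open>With the indicator of the exceptional set, each side of the equivalence says
    that an integral of \<open>u\<close> vanishes.\<close>
  define u :: "real^'n^'m \<Rightarrow> ennreal" where "u = indicator {x. \<not> P x}"
  have [measurable]: "u \<in> borel_measurable borel"
    unfolding u_def by measurable
  have "(\<integral>\<^sup>+x. (\<integral>\<^sup>+y. u (replace_block i y x) \<partial>lborel) \<partial>lborel)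
      = (\<integral>\<^sup>+x. (\<integral>\<^sup>+y. u (x + axis i y) \<partial>lborel) \<partial>lborel)"
  proof (rule nn_integral_cong)
    \<comment> \<open>Measuring \<open>y\<close> from \<open>x $ i\<close> turns the replacement of
      block \<open>i\<close> into the translation by \<open>axis i y\<close>.\<close>
    fix x :: "real^'n^'m"
    show "(\<integral>\<^sup>+y. u (replace_block i y x) \<partial>lborel) = (\<integral>\<^sup>+y. u (x + axis i y) \<partial>lborel)"
      by (subst nn_integral_lborel_shift[where c = "x $ i", symmetric])
        (simp_all add: replace_block_eq_add_axis)
  qed
  also have "\<dots> = (\<integral>\<^sup>+y. (\<integral>\<^sup>+x. u (x + axis i y) \<partial>lborel) \<partial>lborel)"
    by (rule lborel_pair.Fubini') simp
  also have "\<dots> = (\<integral>\<^sup>+(y::real^'n). (\<integral>\<^sup>+x. u x \<partial>lborel) \<partial>lborel)"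
  proof (rule nn_integral_cong)
    fix y :: "real^'n"
    show "(\<integral>\<^sup>+x. u (x + axis i y) \<partial>lborel) = (\<integral>\<^sup>+x. u x \<partial>lborel)"
      using nn_integral_lborel_shift[of u "axis i y"] by (simp add: add.commute)
  qed
  \<comment> \<open>The last expression integrates a constant over a space of infinite measure; it
    is zero exactly when the constant is, so only vanishing can be compared.\<close>
  finally have eq: "(\<integral>\<^sup>+x. (\<integral>\<^sup>+y. u (replace_block i y x) \<partial>lborel) \<partial>lborel) = 0
      \<longleftrightarrow> (\<integral>\<^sup>+x. u x \<partial>lborel) = 0"
    by simp
  have "(AE x in lborel. P x) \<longleftrightarrow> (\<integral>\<^sup>+x. u x \<partial>lborel) = 0"
    by (subst nn_integral_0_iff_AE) (auto simp: u_def indicator_def)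
  moreover have "(AE x in lborel. AE y in lborel. P (replace_block i y x))
      \<longleftrightarrow> (\<integral>\<^sup>+x. (\<integral>\<^sup>+y. u (replace_block i y x) \<partial>lborel) \<partial>lborel) = 0"
  proof -
    have "(AE y in lborel. P (replace_block i y x))
        \<longleftrightarrow> (\<integral>\<^sup>+y. u (replace_block i y x) \<partial>lborel) = 0" for x
      by (subst nn_integral_0_iff_AE) (auto simp: u_def indicator_def)
    then show ?thesis
      by (subst nn_integral_0_iff_AE) auto
  qed
  ultimately show ?thesis
    using eq by simp
qed

section \<open>The norm in a single block\<close>

lemma borel_measurable_block_norm [measurable (raw)]:
  fixes g :: "real^'n^'m::finite \<Rightarrow> ennreal"
  assumes [measurable]: "g \<in> borel_measurable borel"
  shows "block_norm r i g \<in> borel_measurable borel"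
  unfolding block_norm_def[abs_def] by measurable

lemma block_norm_mono:
  assumes "0 < r" "\<And>y. g (replace_block i y x) \<le> h (replace_block i y x)"
  shows "block_norm r i g x \<le> block_norm r i h x"
  unfolding block_norm_def
  using assms by (intro ennreal_powr_mono nn_integral_mono) auto

lemma block_norm_cmult:
  assumes [measurable]: "g \<in> borel_measurable borel" and "0 < r" "0 \<le> c"
  shows "block_norm r i (\<lambda>x. ennreal c * g x) x = ennreal c * block_norm r i g x"
  using assms by (simp add: block_norm_def ennreal_powr_cmult nn_integral_cmult powr_powr)

text \<open>The power inequality is applied twice. Exponent \<open>r\<close> costs
  \<open>2 powr r\<close>, which the root turns into \<open>2\<close>; the root itself costs
  \<open>2 powr (1 / r) \<le> 2\<close>. Together this gives \<open>4\<close>.\<close>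

lemma block_norm_add_le:
  assumes [measurable]: "g \<in> borel_measurable borel" "h \<in> borel_measurable borel" and r: "1 \<le> r"
  shows "block_norm r i (\<lambda>x. g x + h x) x \<le> 4 * (block_norm r i g x + block_norm r i h x)"
proof -
  define G where "G = (\<integral>\<^sup>+ y. ennreal_powr (g (replace_block i y x)) r \<partial>lborel)"
  define H where "H = (\<integral>\<^sup>+ y. ennreal_powr (h (replace_block i y x)) r \<partial>lborel)"
  have "(\<integral>\<^sup>+ y. ennreal_powr (g (replace_block i y x) + h (replace_block i y x)) r \<partial>lborel)
      \<le> (\<integral>\<^sup>+ y. ennreal (2 powr r) * (ennreal_powr (g (replace_block i y x)) r
            + ennreal_powr (h (replace_block i y x)) r) \<partial>lborel)"
    using r by (intro nn_integral_mono ennreal_powr_add_le) auto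
  also have "\<dots> = ennreal (2 powr r) * (G + H)"
    by (simp add: nn_integral_cmult nn_integral_add G_def H_def)
  finally have "block_norm r i (\<lambda>x. g x + h x) x
      \<le> ennreal_powr (ennreal (2 powr r) * (G + H)) (1 / r)"
    unfolding block_norm_def using r by (intro ennreal_powr_mono) auto
  also have "\<dots> = 2 * ennreal_powr (G + H) (1 / r)"
    using r by (subst ennreal_powr_cmult) (simp_all add: powr_powr)
  also have "\<dots> \<le> 2 * (ennreal (2 powr (1 / r)) * (ennreal_powr G (1 / r) + ennreal_powr H (1 / r)))"
    using r by (intro mult_left_mono ennreal_powr_add_le) auto
  also have "\<dots> \<le> 2 * (2 * (ennreal_powr G (1 / r) + ennreal_powr H (1 / r)))"
  proof -
    have "2 powr (1 / r) \<le> 2 powr 1"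
      using r by (intro powr_mono) auto
    then have "ennreal (2 powr (1 / r)) \<le> ennreal 2"
      by (intro ennreal_leI) simp
    then show ?thesis
      by (intro mult_left_mono mult_right_mono) auto
  qed
  also have "\<dots> = 4 * (block_norm r i g x + block_norm r i h x)"
    unfolding block_norm_def G_def H_def mult.assoc[symmetric] by simp
  finally show ?thesis .
qed

text \<open>Translation invariance of the integral absorbs the component \<open>z $ i\<close>; the
  other components only move the point of evaluation.\<close>

lemma block_norm_shift:
  assumes [measurable]: "g \<in> borel_measurable borel"
  shows "block_norm r i (\<lambda>x. g (x - z)) x = block_norm r i g (x - z)"
proof -
  have "(\<integral>\<^sup>+ y. ennreal_powr (g (replace_block i y x - z)) r \<partial>lborel)
      = (\<integral>\<^sup>+ y. ennreal_powr (g (replace_block i (- (z $ i) + y) (x - z))) r \<partial>lborel)"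
    by (simp add: replace_block_diff)
  also have "\<dots> = (\<integral>\<^sup>+ y. ennreal_powr (g (replace_block i y (x - z))) r \<partial>lborel)"
    by (rule nn_integral_lborel_shift) simp
  finally show ?thesis
    by (simp add: block_norm_def)
qed

text \<open>A finite integral forces a finite integrand almost everywhere on the slice, and
  \<open>AE_block_iff\<close> assembles the slices.\<close>

lemma AE_block_norm_finite:
  assumes [measurable]: "g \<in> borel_measurable borel"
    and fin: "AE x in lborel. block_norm r i g x < top"
  shows "AE x in lborel. g x < top"
proof -
  have "AE y in lborel. g (replace_block i y x) < top" if "block_norm r i g x < top" for x
  proof -
    have "(\<integral>\<^sup>+ y. ennreal_powr (g (replace_block i y x)) r \<partial>lborel) \<noteq> \<infinity>"
      using that by (auto simp: block_norm_def ennreal_powr_def)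
    then have "AE y in lborel. ennreal_powr (g (replace_block i y x)) r \<noteq> \<infinity>"
      by (rule nn_integral_noteq_infinite[rotated]) simp
    then show ?thesis
      by (simp add: ennreal_powr_eq_top_iff less_top)
  qed
  then have "AE x in lborel. AE y in lborel. g (replace_block i y x) < top"
    using fin by auto
  then show ?thesis
    by (subst (asm) AE_block_iff) simp_all
qed

lemma AE_block_norm_eq_0:
  assumes [measurable]: "g \<in> borel_measurable borel"
    and zero: "AE x in lborel. block_norm r i g x = 0"
  shows "AE x in lborel. g x = 0"
proof -
  have "AE y in lborel. g (replace_block i y x) = 0" if "block_norm r i g x = 0" for x
    using that unfolding block_norm_def
    by (simp add: ennreal_powr_eq_0_iff nn_integral_0_iff_AE)
  then have "AE x in lborel. AE y in lborel. g (replace_block i y x) = 0"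
    using zero by auto
  then show ?thesis
    by (subst (asm) AE_block_iff) simp_all
qed

lemma block_norm_cong_AE:
  assumes [measurable]: "g \<in> borel_measurable borel" "h \<in> borel_measurable borel"
    and eq: "AE x in lborel. g x = h x"
  shows "AE x in lborel. block_norm r i g x = block_norm r i h x"
proof -
  have "AE x in lborel. AE y in lborel. g (replace_block i y x) = h (replace_block i y x)"
    using eq by (subst AE_block_iff) simp_all
  then show ?thesis
  proof eventually_elim
    case (elim x)
    then have "(\<integral>\<^sup>+ y. ennreal_powr (g (replace_block i y x)) r \<partial>lborel)
        = (\<integral>\<^sup>+ y. ennreal_powr (h (replace_block i y x)) r \<partial>lborel)"
      by (intro nn_integral_cong_AE) auto
    then show ?case
      by (simp add: block_norm_def)
  qed
qed

text \<open>Dominated convergence on almost every slice, with the \<open>r\<close>-th power of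
  \<open>h\<close> as the majorant.\<close>

lemma block_norm_tendsto_0:
  fixes g :: "nat \<Rightarrow> real^'n^'m::finite \<Rightarrow> ennreal"
  assumes [measurable]: "\<And>n. g n \<in> borel_measurable borel" "h \<in> borel_measurable borel"
    and le: "\<And>n x. g n x \<le> h x"
    and lim: "AE x in lborel. (\<lambda>n. g n x) \<longlonglongrightarrow> 0"
    and fin: "AE x in lborel. block_norm r i h x < top"
    and r: "0 < r"
  shows "AE x in lborel. (\<lambda>n. block_norm r i (g n) x) \<longlonglongrightarrow> 0"
proof -
  have "AE x in lborel. AE y in lborel. (\<lambda>n. g n (replace_block i y x)) \<longlonglongrightarrow> 0"
    using lim by (subst AE_block_iff) simp_all
  then show ?thesis
    using fin
  proof eventually_elim
    case (elim x)
    have "(\<lambda>n. \<integral>\<^sup>+ y. ennreal_powr (g n (replace_block i y x)) r \<partial>lborel)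
        \<longlonglongrightarrow> (\<integral>\<^sup>+ (y::real^'n). 0 \<partial>lborel)"
    proof (rule nn_integral_dominated_convergence)
      show "(\<integral>\<^sup>+ y. ennreal_powr (h (replace_block i y x)) r \<partial>lborel) < \<infinity>"
        using elim(2) unfolding block_norm_def
        by (metis ennreal_powr_eq_top_iff infinity_ennreal_def less_top)
      show "AE y in lborel. (\<lambda>n. ennreal_powr (g n (replace_block i y x)) r) \<longlonglongrightarrow> 0"
        using elim(1) by eventually_elim (rule tendsto_ennreal_powr_0[OF _ r])
    qed (use r in \<open>auto intro!: ennreal_powr_mono le\<close>)
    then show ?case
      unfolding block_norm_def using r by (intro tendsto_ennreal_powr_0) auto
  qed
qed

section \<open>Sums of separated translates under one block norm\<close>

text \<open>The sum is its only possibly nonzero term, so any \<open>\<phi>\<close> fixing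
  \<open>0\<close> passes through it. This is applied to powers, to roots and to the norm.\<close>

lemma sum_at_most_one_nonzero:
  fixes a :: "nat \<Rightarrow> 'a::comm_monoid_add" and \<phi> :: "'a \<Rightarrow> 'b::comm_monoid_add"
  assumes "\<phi> 0 = 0"
    and "\<And>j k. j < N \<Longrightarrow> k < N \<Longrightarrow> j \<noteq> k \<Longrightarrow> a j = 0 \<or> a k = 0"
  shows "\<phi> (\<Sum>j<N. a j) = (\<Sum>j<N. \<phi> (a j))"
proof (cases "\<exists>l<N. a l \<noteq> 0")
  case True
  then obtain l where l: "l < N" "a l \<noteq> 0"
    by auto
  have zero: "a j = 0" if "j \<in> {..<N} - {l}" for j
    using assms(2)[of j l] l that by auto
  have "(\<Sum>j<N. a j) = a l + (\<Sum>j\<in>{..<N} - {l}. a j)"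
    using l by (intro sum.remove) auto
  moreover have "(\<Sum>j<N. \<phi> (a j)) = \<phi> (a l) + (\<Sum>j\<in>{..<N} - {l}. \<phi> (a j))"
    using l by (intro sum.remove) auto
  ultimately show ?thesis
    using zero assms(1) by simp
qed (use assms(1) in simp)

text \<open>
  In the next lemmas \<open>g\<close> lives on the slab \<open>norm (x $ i) \<le> R\<close>, and the shifts \<open>h j\<close> are so far apart
  that the translated slabs are disjoint.
\<close>

lemma separated_shifts_disjoint:
  fixes g :: "real^'n^'m::finite \<Rightarrow> 'a::zero"
  assumes "\<And>x. R < norm (x $ i) \<Longrightarrow> g x = 0"
    and "\<And>j k. j < N \<Longrightarrow> k < N \<Longrightarrow> j \<noteq> k \<Longrightarrow> 2 * R < norm (h j - h k)"
    and "j < N" "k < N" "j \<noteq> k"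
  shows "g (x - axis i (h j)) = 0 \<or> g (x - axis i (h k)) = 0"
proof (rule ccontr)
  assume "\<not> ?thesis"
  then have "norm (x $ i - h j) \<le> R" "norm (x $ i - h k) \<le> R"
    using assms(1)[of "x - axis i (h j)"] assms(1)[of "x - axis i (h k)"]
    by (auto simp: axis_def not_less[symmetric])
  moreover have "norm (h j - h k) \<le> norm (x $ i - h k) + norm (x $ i - h j)"
    using norm_triangle_ineq4[of "x $ i - h k" "x $ i - h j"] by simp
  ultimately show False
    using assms(2)[OF assms(3-5)] by simp
qed

text \<open>A norm in another block keeps the coordinate \<open>x $ i\<close> fixed, so the support
  in the slab survives all norms taken before block \<open>i\<close>.\<close>

lemma block_norm_eq_0_outside_slab:
  assumes "\<And>x. R < norm (x $ i) \<Longrightarrow> g x = 0" "k \<noteq> i" "R < norm (x $ i)"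
  shows "block_norm r k g x = 0"
  using assms by (simp add: block_norm_def replace_block_nth)

text \<open>Disjointness is used twice: pointwise for the power \<open>r\<close>, and after
  integration for the root, since the integral in block \<open>k\<close> still vanishes off the
  slab.\<close>

lemma block_norm_sum_shifts_other:
  fixes g :: "real^'n^'m::finite \<Rightarrow> ennreal" and h :: "nat \<Rightarrow> real^'n"
  assumes [measurable]: "g \<in> borel_measurable borel"
    and supp: "\<And>x. R < norm (x $ i) \<Longrightarrow> g x = 0"
    and sep: "\<And>j k. j < N \<Longrightarrow> k < N \<Longrightarrow> j \<noteq> k \<Longrightarrow> 2 * R < norm (h j - h k)"
    and k: "k \<noteq> i"
  shows "block_norm r k (\<lambda>x. \<Sum>j<N. g (x - axis i (h j))) x
    = (\<Sum>j<N. block_norm r k g (x - axis i (h j)))"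
proof -
  define I where "I = (\<lambda>x. \<integral>\<^sup>+ y. ennreal_powr (g (replace_block k y x)) r \<partial>lborel)"
  have rep: "replace_block k y x - axis i (h j) = replace_block k y (x - axis i (h j))" for y j
    using k by (simp add: vec_eq_iff replace_block_nth axis_def)
  have "(\<integral>\<^sup>+ y. ennreal_powr (\<Sum>j<N. g (replace_block k y x - axis i (h j))) r \<partial>lborel)
      = (\<integral>\<^sup>+ y. (\<Sum>j<N. ennreal_powr (g (replace_block k y x - axis i (h j))) r) \<partial>lborel)"
  proof (rule nn_integral_cong)
    fix y
    show "ennreal_powr (\<Sum>j<N. g (replace_block k y x - axis i (h j))) r
        = (\<Sum>j<N. ennreal_powr (g (replace_block k y x - axis i (h j))) r)"
      by (rule sum_at_most_one_nonzero[where \<phi> = "\<lambda>a. ennreal_powr a r"])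
        (simp, rule separated_shifts_disjoint[OF supp sep])
  qed
  also have "\<dots> = (\<Sum>j<N. I (x - axis i (h j)))"
    by (subst nn_integral_sum) (simp_all add: rep I_def)
  finally have "block_norm r k (\<lambda>x. \<Sum>j<N. g (x - axis i (h j))) x
      = ennreal_powr (\<Sum>j<N. I (x - axis i (h j))) (1 / r)"
    by (simp add: block_norm_def)
  also have "\<dots> = (\<Sum>j<N. ennreal_powr (I (x - axis i (h j))) (1 / r))"
  proof (rule sum_at_most_one_nonzero)
    have "R < norm (x $ i) \<Longrightarrow> I x = 0" for x
      using k by (simp add: I_def supp replace_block_nth)
    then show "I (x - axis i (h j)) = 0 \<or> I (x - axis i (h l)) = 0"
      if "j < N" "l < N" "j \<noteq> l" for j l
      using separated_shifts_disjoint[of R i I N h j l x] sep that by blast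
  qed simp
  finally show ?thesis
    by (simp add: block_norm_def I_def)
qed

text \<open>In block \<open>i\<close> itself the shifts are integrated out. Each translate
  contributes the same integral \<open>I\<close>, so the \<open>r\<close>-th powers add up to
  \<open>N * I\<close>, and the root yields the factor.\<close>

lemma block_norm_sum_shifts_same:
  fixes g :: "real^'n^'m::finite \<Rightarrow> ennreal" and h :: "nat \<Rightarrow> real^'n"
  assumes [measurable]: "g \<in> borel_measurable borel"
    and supp: "\<And>x. R < norm (x $ i) \<Longrightarrow> g x = 0"
    and sep: "\<And>j k. j < N \<Longrightarrow> k < N \<Longrightarrow> j \<noteq> k \<Longrightarrow> 2 * R < norm (h j - h k)"
  shows "block_norm r i (\<lambda>x. \<Sum>j<N. g (x - axis i (h j))) x
    = ennreal (real N powr (1 / r)) * block_norm r i g x"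
proof -
  define I where "I = (\<integral>\<^sup>+ y. ennreal_powr (g (replace_block i y x)) r \<partial>lborel)"
  have rep: "replace_block i y x - axis i (h j) = replace_block i (- h j + y) x" for y j
    by (simp add: vec_eq_iff replace_block_nth axis_def)
  have "(\<integral>\<^sup>+ y. ennreal_powr (\<Sum>j<N. g (replace_block i y x - axis i (h j))) r \<partial>lborel)
      = (\<integral>\<^sup>+ y. (\<Sum>j<N. ennreal_powr (g (replace_block i y x - axis i (h j))) r) \<partial>lborel)"
  proof (rule nn_integral_cong)
    fix y
    show "ennreal_powr (\<Sum>j<N. g (replace_block i y x - axis i (h j))) r
        = (\<Sum>j<N. ennreal_powr (g (replace_block i y x - axis i (h j))) r)"
      by (rule sum_at_most_one_nonzero[where \<phi> = "\<lambda>a. ennreal_powr a r"])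
        (simp, rule separated_shifts_disjoint[OF supp sep])
  qed
  also have "\<dots> = (\<Sum>j<N. \<integral>\<^sup>+ y. ennreal_powr (g (replace_block i (- h j + y) x)) r \<partial>lborel)"
    by (subst nn_integral_sum) (simp_all add: rep)
  also have "\<dots> = (\<Sum>j<N. I)"
    unfolding I_def by (intro sum.cong refl nn_integral_lborel_shift) simp
  also have "\<dots> = ennreal (real N) * I"
    by (simp add: ennreal_of_nat_eq_real_of_nat)
  finally show ?thesis
    by (simp add: block_norm_def ennreal_powr_cmult I_def)
qed

section \<open>Norms iterated over a list of blocks\<close>

text \<open>An arbitrary list in place of the sorted list of all blocks permits induction and
  splitting at block \<open>i\<close>.\<close>

definition iterated_norm ::
  "('m \<Rightarrow> real) \<Rightarrow> 'm::finite list \<Rightarrow> (real^'n^'m \<Rightarrow> ennreal) \<Rightarrow> real^'n^'m \<Rightarrow> ennreal"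
  where "iterated_norm p xs = fold (\<lambda>i. block_norm (p i) i) xs"

lemma iterated_norm_Nil [simp]: "iterated_norm p [] g = g"
  by (simp add: iterated_norm_def)

lemma iterated_norm_Cons [simp]:
  "iterated_norm p (i # xs) g = iterated_norm p xs (block_norm (p i) i g)"
  by (simp add: iterated_norm_def)

lemma iterated_norm_append:
  "iterated_norm p (xs @ ys) g = iterated_norm p ys (iterated_norm p xs g)"
  by (simp add: iterated_norm_def)

lemma borel_measurable_iterated_norm [measurable (raw)]:
  "g \<in> borel_measurable borel \<Longrightarrow> iterated_norm p xs g \<in> borel_measurable borel"
  by (induction xs arbitrary: g) (simp_all add: borel_measurable_block_norm)

lemma iterated_norm_mono:
  assumes "\<And>i. 0 < p i" "\<And>x. g x \<le> h x"
  shows "iterated_norm p xs g x \<le> iterated_norm p xs h x"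
  using assms(2) by (induction xs arbitrary: g h) (simp_all add: assms(1) block_norm_mono)

lemma iterated_norm_cmult:
  assumes "g \<in> borel_measurable borel" "\<And>i. 0 < p i" "0 \<le> c"
  shows "iterated_norm p xs (\<lambda>x. ennreal c * g x) = (\<lambda>x. ennreal c * iterated_norm p xs g x)"
  using assms(1)
proof (induction xs arbitrary: g)
  case (Cons i xs)
  have "block_norm (p i) i (\<lambda>x. ennreal c * g x) = (\<lambda>x. ennreal c * block_norm (p i) i g x)"
    using Cons.prems assms by (intro ext block_norm_cmult) auto
  then show ?case
    using Cons by (simp add: borel_measurable_block_norm)
qed simp

lemma iterated_norm_shift:
  assumes "g \<in> borel_measurable borel"
  shows "iterated_norm p xs (\<lambda>x. g (x - z)) = (\<lambda>x. iterated_norm p xs g (x - z))"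
  using assms
proof (induction xs arbitrary: g)
  case (Cons i xs)
  have "block_norm (p i) i (\<lambda>x. g (x - z)) = (\<lambda>x. block_norm (p i) i g (x - z))"
    using Cons.prems by (intro ext block_norm_shift)
  then show ?case
    using Cons by (simp add: borel_measurable_block_norm)
qed simp

text \<open>Monotonicity carries the inequality for one block through the remaining norms, and
  homogeneity pulls out its factor 4.\<close>

lemma iterated_norm_add_le:
  assumes "g \<in> borel_measurable borel" "h \<in> borel_measurable borel" and p: "\<And>i. 1 \<le> p i"
  shows "iterated_norm p xs (\<lambda>x. g x + h x) x
    \<le> 4 ^ length xs * (iterated_norm p xs g x + iterated_norm p xs h x)"
  using assms(1,2)
proof (induction xs arbitrary: g h)
  case (Cons i xs)
  note [measurable] = Cons.prems
  have p': "0 < p i" for i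
    using p[of i] by simp
  have "iterated_norm p (i # xs) (\<lambda>x. g x + h x) x
      \<le> iterated_norm p xs (\<lambda>x. ennreal 4 * (block_norm (p i) i g x + block_norm (p i) i h x)) x"
    using block_norm_add_le[OF Cons.prems p] by (auto intro!: iterated_norm_mono p')
  also have "\<dots> = 4 * iterated_norm p xs (\<lambda>x. block_norm (p i) i g x + block_norm (p i) i h x) x"
    by (subst iterated_norm_cmult) (simp_all add: p')
  also have "\<dots> \<le> 4 * (4 ^ length xs * (iterated_norm p xs (block_norm (p i) i g) x
      + iterated_norm p xs (block_norm (p i) i h) x))"
    by (intro mult_left_mono Cons.IH) simp_all
  finally show ?case
    by (simp add: mult.assoc)
qed simp

lemma iterated_norm_cong_AE:
  assumes "g \<in> borel_measurable borel" "h \<in> borel_measurable borel"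
    and "AE x in lborel. g x = h x"
  shows "AE x in lborel. iterated_norm p xs g x = iterated_norm p xs h x"
  using assms
  by (induction xs arbitrary: g h)
    (simp_all add: borel_measurable_block_norm block_norm_cong_AE)

text \<open>Finiteness travels inward from the outermost norm. It makes the majorant admissible at
  every stage of \<open>iterated_norm_tendsto_0\<close>.\<close>

lemma AE_iterated_norm_finite:
  assumes "g \<in> borel_measurable borel" "AE x in lborel. iterated_norm p xs g x < top"
  shows "AE x in lborel. g x < top"
  using assms
proof (induction xs arbitrary: g)
  case (Cons i xs)
  have "AE x in lborel. block_norm (p i) i g x < top"
    using Cons by (simp add: borel_measurable_block_norm)
  then show ?case
    by (rule AE_block_norm_finite[OF Cons.prems(1)])
qed simp

lemma AE_iterated_norm_eq_0:
  assumes "g \<in> borel_measurable borel" "AE x in lborel. iterated_norm p xs g x = 0"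
  shows "AE x in lborel. g x = 0"
  using assms
proof (induction xs arbitrary: g)
  case (Cons i xs)
  have "AE x in lborel. block_norm (p i) i g x = 0"
    using Cons by (simp add: borel_measurable_block_norm)
  then show ?case
    by (rule AE_block_norm_eq_0[OF Cons.prems(1)])
qed simp

text \<open>Dominated convergence is repeated block by block; the block norm of \<open>h\<close> is
  the majorant for the next block.\<close>

lemma iterated_norm_tendsto_0:
  fixes g :: "nat \<Rightarrow> real^'n^'m::finite \<Rightarrow> ennreal"
  assumes "\<And>n. g n \<in> borel_measurable borel" "h \<in> borel_measurable borel"
    and "\<And>n x. g n x \<le> h x"
    and "AE x in lborel. (\<lambda>n. g n x) \<longlonglongrightarrow> 0"
    and "AE x in lborel. iterated_norm p xs h x < top"
    and p: "\<And>i. 0 < p i"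
  shows "AE x in lborel. (\<lambda>n. iterated_norm p xs (g n) x) \<longlonglongrightarrow> 0"
  using assms(1-5)
proof (induction xs arbitrary: g h)
  case (Cons i xs)
  note [measurable] = Cons.prems(1,2)
  have "AE x in lborel. block_norm (p i) i h x < top"
    using Cons.prems(5) by (intro AE_iterated_norm_finite[of "block_norm (p i) i h" p xs]) simp_all
  then have "AE x in lborel. (\<lambda>n. block_norm (p i) i (g n) x) \<longlonglongrightarrow> 0"
    by (rule block_norm_tendsto_0[OF Cons.prems(1-4) _ p])
  then have "AE x in lborel. (\<lambda>n. iterated_norm p xs (block_norm (p i) i (g n)) x) \<longlonglongrightarrow> 0"
    using Cons.prems(3,5) p
    by (intro Cons.IH[of "\<lambda>n. block_norm (p i) i (g n)" "block_norm (p i) i h"] block_norm_mono)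
      simp_all
  then show ?case
    by simp
qed simp

text \<open>The induction removes the last block, whose norm is outermost: inserting the same
  \<open>z\<close> into block \<open>i\<close> of both points makes them agree there too. For the
  list of all blocks the result is constant.\<close>

lemma iterated_norm_indep:
  assumes "\<And>j. j \<notin> set xs \<Longrightarrow> x $ j = y $ j"
  shows "iterated_norm p xs g x = iterated_norm p xs g y"
  using assms
proof (induction xs arbitrary: x y rule: rev_induct)
  case Nil
  then have "x = y"
    by (simp add: vec_eq_iff)
  then show ?case
    by simp
next
  case (snoc i xs)
  have "iterated_norm p xs g (replace_block i z x) = iterated_norm p xs g (replace_block i z y)" for z
    using snoc.prems by (intro snoc.IH) (auto simp: replace_block_nth)
  then show ?case
    by (simp add: iterated_norm_append block_norm_def)
qed

section \<open>Sums of separated translates under iterated norms\<close>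

lemma iterated_norm_sum_shifts_other:
  fixes g :: "real^'n^'m::finite \<Rightarrow> ennreal" and h :: "nat \<Rightarrow> real^'n"
  assumes "g \<in> borel_measurable borel"
    and "\<And>x. R < norm (x $ i) \<Longrightarrow> g x = 0"
    and sep: "\<And>j k. j < N \<Longrightarrow> k < N \<Longrightarrow> j \<noteq> k \<Longrightarrow> 2 * R < norm (h j - h k)"
    and "i \<notin> set xs"
  shows "iterated_norm p xs (\<lambda>x. \<Sum>j<N. g (x - axis i (h j)))
      = (\<lambda>x. \<Sum>j<N. iterated_norm p xs g (x - axis i (h j)))"
    and "R < norm (x $ i) \<Longrightarrow> iterated_norm p xs g x = 0"
proof -
  have "iterated_norm p xs (\<lambda>x. \<Sum>j<N. g (x - axis i (h j)))
        = (\<lambda>x. \<Sum>j<N. iterated_norm p xs g (x - axis i (h j)))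
      \<and> (\<forall>x. R < norm (x $ i) \<longrightarrow> iterated_norm p xs g x = 0)"
    using assms(1,2,4)
  proof (induction xs arbitrary: g)
    case (Cons k xs)
    have "block_norm (p k) k (\<lambda>x. \<Sum>j<N. g (x - axis i (h j)))
        = (\<lambda>x. \<Sum>j<N. block_norm (p k) k g (x - axis i (h j)))"
      using Cons.prems by (intro ext block_norm_sum_shifts_other[OF _ _ sep]) auto
    moreover have "block_norm (p k) k g x = 0" if "R < norm (x $ i)" for x
      using Cons.prems that by (intro block_norm_eq_0_outside_slab[of R i]) auto
    ultimately show ?case
      using Cons.IH[of "block_norm (p k) k g"] Cons.prems
      by (simp add: borel_measurable_block_norm)
  qed simp
  then show "iterated_norm p xs (\<lambda>x. \<Sum>j<N. g (x - axis i (h j)))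
      = (\<lambda>x. \<Sum>j<N. iterated_norm p xs g (x - axis i (h j)))"
    and "R < norm (x $ i) \<Longrightarrow> iterated_norm p xs g x = 0"
    by auto
qed

text \<open>The list is split at \<open>i\<close>. Norms before \<open>i\<close> act on each
  translate separately, the norm in block \<open>i\<close> produces the factor, and the norms after
  \<open>i\<close> pull it out by homogeneity.\<close>

lemma iterated_norm_sum_shifts:
  fixes g :: "real^'n^'m::finite \<Rightarrow> ennreal" and h :: "nat \<Rightarrow> real^'n"
  assumes [measurable]: "g \<in> borel_measurable borel"
    and supp: "\<And>x. R < norm (x $ i) \<Longrightarrow> g x = 0"
    and sep: "\<And>j k. j < N \<Longrightarrow> k < N \<Longrightarrow> j \<noteq> k \<Longrightarrow> 2 * R < norm (h j - h k)"
    and xs: "i \<in> set xs" "distinct xs" and p: "\<And>i. 0 < p i"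
  shows "iterated_norm p xs (\<lambda>x. \<Sum>j<N. g (x - axis i (h j))) x
    = ennreal (real N powr (1 / p i)) * iterated_norm p xs g x"
proof -
  obtain us vs where split: "xs = us @ i # vs"
    using split_list[OF xs(1)] by blast
  then have i: "i \<notin> set us"
    using xs(2) by auto
  define G where "G = iterated_norm p us g"
  have [measurable]: "G \<in> borel_measurable borel"
    by (simp add: G_def borel_measurable_iterated_norm)
  have "block_norm (p i) i (\<lambda>x. \<Sum>j<N. G (x - axis i (h j)))
      = (\<lambda>x. ennreal (real N powr (1 / p i)) * block_norm (p i) i G x)"
    using iterated_norm_sum_shifts_other(2)[OF assms(1) supp sep i] sep
    by (intro ext block_norm_sum_shifts_same) (auto simp: G_def)
  then show ?thesis
    using iterated_norm_sum_shifts_other(1)[OF assms(1) supp sep i] p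
    by (simp add: split iterated_norm_append G_def[symmetric] iterated_norm_cmult)
qed

section \<open>Basic properties of the mixed norm\<close>

text \<open>The point \<open>x\<close> is free since the full iterated norm is constant. This allows
  almost everywhere statements about iterated norms to be read as statements about numbers.\<close>

lemma mixed_norm_eq_iterated_norm:
  "mixed_norm p f = iterated_norm p (sorted_list_of_set UNIV) (\<lambda>x. ennreal (norm (f x))) x"
  unfolding mixed_norm_def iterated_norm_def[symmetric]
  by (rule iterated_norm_indep) simp

lemma mixed_norm_zero:
  assumes "\<And>i. 0 < p i"
  shows "mixed_norm p (\<lambda>x::real^'n^'m::{finite,linorder}. 0) = 0"
  using iterated_norm_cmult[of "\<lambda>_::real^'n^'m::{finite,linorder}. 0" p 0] assms
  by (simp add: mixed_norm_eq_iterated_norm[where x = 0])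

lemma mixed_norm_uminus: "mixed_norm p (\<lambda>x. - f x) = mixed_norm p f"
  by (simp add: mixed_norm_def)

lemma mixed_norm_mono:
  assumes "\<And>i. 0 < p i" "\<And>x. norm (f x) \<le> norm (g x)"
  shows "mixed_norm p f \<le> mixed_norm p g"
  unfolding mixed_norm_eq_iterated_norm[where x = 0]
  using assms by (intro iterated_norm_mono ennreal_leI) auto

lemma mixed_norm_add_le:
  fixes f g :: "real^'n^'m::{finite,linorder} \<Rightarrow> complex"
  assumes [measurable]: "f \<in> borel_measurable borel" "g \<in> borel_measurable borel"
    and p: "\<And>i. 1 \<le> p i"
  shows "mixed_norm p (\<lambda>x. f x + g x) \<le> 4 ^ CARD('m) * (mixed_norm p f + mixed_norm p g)"
proof -
  have "mixed_norm p (\<lambda>x. f x + g x)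
      \<le> iterated_norm p (sorted_list_of_set UNIV) (\<lambda>x. ennreal (norm (f x)) + ennreal (norm (g x))) 0"
    unfolding mixed_norm_eq_iterated_norm[where x = 0] using p
    by (intro iterated_norm_mono)
      (auto simp: ennreal_plus[symmetric] norm_triangle_ineq less_le_trans[OF zero_less_one] simp del: ennreal_plus)
  also have "\<dots> \<le> 4 ^ length (sorted_list_of_set (UNIV :: 'm set)) * (mixed_norm p f + mixed_norm p g)"
    unfolding mixed_norm_eq_iterated_norm[where x = 0]
    using p by (intro iterated_norm_add_le) auto
  finally show ?thesis
    by simp
qed

text \<open>The constant grows exponentially in \<open>N\<close>. This is harmless, as the bound is
  applied only to tails, which tend to \<open>0\<close> while \<open>N\<close> stays fixed.\<close>

lemma mixed_norm_sum_le:
  fixes u :: "nat \<Rightarrow> real^'n^'m::{finite,linorder} \<Rightarrow> complex"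
  assumes [measurable]: "\<And>j. u j \<in> borel_measurable borel" and p: "\<And>i. 1 \<le> p i"
  shows "mixed_norm p (\<lambda>x. \<Sum>j<N. u j x) \<le> (4 ^ CARD('m)) ^ N * (\<Sum>j<N. mixed_norm p (u j))"
proof (induction N)
  case 0
  show ?case
    using p by (simp add: mixed_norm_zero less_le_trans[OF zero_less_one])
next
  case (Suc N)
  define K :: ennreal where "K = 4 ^ CARD('m)"
  \<comment> \<open>This lets the new summand carry the same factor \<open>K ^ N\<close> as the
    earlier ones.\<close>
  have "1 \<le> K ^ N"
    unfolding K_def by (intro one_le_power) simp
  have "mixed_norm p (\<lambda>x. \<Sum>j<Suc N. u j x)
      \<le> K * (mixed_norm p (\<lambda>x. \<Sum>j<N. u j x) + mixed_norm p (u N))"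
    unfolding sum.lessThan_Suc K_def using p by (intro mixed_norm_add_le) auto
  also have "\<dots> \<le> K * (K ^ N * (\<Sum>j<N. mixed_norm p (u j)) + K ^ N * mixed_norm p (u N))"
    using Suc.IH mult_right_mono[OF \<open>1 \<le> K ^ N\<close>, of "mixed_norm p (u N)"]
    by (intro mult_left_mono add_mono) (auto simp: K_def)
  finally show ?case
    by (simp add: K_def distrib_left mult.assoc)
qed

lemma mixed_norm_translate:
  assumes [measurable]: "f \<in> borel_measurable borel"
  shows "mixed_norm p (translate z f) = mixed_norm p f"
  \<comment> \<open>Translation by \<open>z\<close> moves the evaluation point from \<open>0\<close>
    to \<open>- z\<close>, where the constant iterated norm has the same value.\<close>
  using iterated_norm_shift[of "\<lambda>x. ennreal (norm (f x))" p "sorted_list_of_set UNIV" z]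
    mixed_norm_eq_iterated_norm[of p f "- z"] mixed_norm_eq_iterated_norm[of p "translate z f" 0]
  by (simp add: translate_def)

text \<open>The measure \<open>lborel\<close> is not null, so a statement free of \<open>x\<close>
  that holds almost everywhere simply holds.\<close>

lemma AE_lborel_const: "(AE x in (lborel :: 'a::euclidean_space measure). P) \<longleftrightarrow> P"
  by (rule eventually_const) (simp add: ae_filter_eq_bot_iff emeasure_lborel_UNIV)

lemma mixed_norm_cong_AE:
  fixes f g :: "real^'n^'m::{finite,linorder} \<Rightarrow> complex"
  assumes [measurable]: "f \<in> borel_measurable borel" "g \<in> borel_measurable borel"
    and "AE x in lborel. f x = g x"
  shows "mixed_norm p f = mixed_norm p g"
proof -
  have "AE x in lborel. ennreal (norm (f x)) = ennreal (norm (g x))"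
    using assms(3) by eventually_elim simp
  then have "AE x in (lborel :: (real^'n^'m::{finite,linorder}) measure). mixed_norm p f = mixed_norm p g"
    using iterated_norm_cong_AE[of "\<lambda>x. ennreal (norm (f x))" "\<lambda>x. ennreal (norm (g x))" p
        "sorted_list_of_set UNIV"]
    by (simp add: mixed_norm_eq_iterated_norm[symmetric])
  then show ?thesis
    by (simp add: AE_lborel_const)
qed

lemma mixed_norm_eq_0D:
  assumes [measurable]: "f \<in> borel_measurable borel" and "mixed_norm p f = 0"
  shows "AE x in lborel. f x = 0"
  using AE_iterated_norm_eq_0[of "\<lambda>x. ennreal (norm (f x))" p "sorted_list_of_set UNIV"] assms(2)
  by (simp add: mixed_norm_eq_iterated_norm[symmetric])

text \<open>At each point the tail is eventually \<open>0\<close>, and \<open>norm (f x)\<close>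
  dominates it.\<close>

lemma mixed_norm_tail_tendsto_0:
  fixes f :: "real^'n^'m::{finite,linorder} \<Rightarrow> complex"
  assumes [measurable]: "f \<in> borel_measurable borel" and fin: "mixed_norm p f < top"
    and p: "\<And>i. 0 < p i"
  shows "(\<lambda>n. mixed_norm p (\<lambda>x. if norm (x $ i) \<le> real n then 0 else f x)) \<longlonglongrightarrow> 0"
proof -
  define t where "t = (\<lambda>n x. if norm (x $ i) \<le> real n then 0 else f x)"
  have [measurable]: "t n \<in> borel_measurable borel" for n
    unfolding t_def by measurable
  have "(\<lambda>n. ennreal (norm (t n x))) \<longlonglongrightarrow> 0" for x
  proof (rule tendsto_eventually)
    have "\<forall>\<^sub>F n in sequentially. norm (x $ i) \<le> real n"
      by (rule eventually_sequentiallyI[of "nat \<lceil>norm (x $ i)\<rceil>"]) linarith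
    then show "\<forall>\<^sub>F n in sequentially. ennreal (norm (t n x)) = 0"
      by eventually_elim (simp add: t_def)
  qed
  then have "AE x in lborel.
      (\<lambda>n. iterated_norm p (sorted_list_of_set UNIV) (\<lambda>x. ennreal (norm (t n x))) x) \<longlonglongrightarrow> 0"
    using fin p
    by (intro iterated_norm_tendsto_0[where h = "\<lambda>x. ennreal (norm (f x))"])
      (auto simp: mixed_norm_eq_iterated_norm[symmetric] t_def)
  then have "AE x in (lborel :: (real^'n^'m::{finite,linorder}) measure). (\<lambda>n. mixed_norm p (t n)) \<longlonglongrightarrow> 0"
    by (simp add: mixed_norm_eq_iterated_norm[symmetric])
  then show ?thesis
    by (simp add: t_def AE_lborel_const)
qed

section \<open>Mixed norms of sums of translates\<close>

lemma mixed_norm_sum_translates: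
  fixes f :: "real^'n^'m::{finite,linorder} \<Rightarrow> complex" and h :: "nat \<Rightarrow> real^'n"
  assumes [measurable]: "f \<in> borel_measurable borel"
    and supp: "\<And>x. R < norm (x $ i) \<Longrightarrow> f x = 0"
    and sep: "\<And>j k. j < N \<Longrightarrow> k < N \<Longrightarrow> j \<noteq> k \<Longrightarrow> 2 * R < norm (h j - h k)"
    and p: "\<And>i. 0 < p i"
  shows "mixed_norm p (\<lambda>x. \<Sum>j<N. translate (axis i (h j)) f x)
    = ennreal (real N powr (1 / p i)) * mixed_norm p f"
proof -
  have "ennreal (norm (\<Sum>j<N. f (x - axis i (h j)))) = (\<Sum>j<N. ennreal (norm (f (x - axis i (h j)))))" for x
    by (rule sum_at_most_one_nonzero[where \<phi> = "\<lambda>z. ennreal (norm z)"])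
      (simp, rule separated_shifts_disjoint[OF supp sep])
  then show ?thesis
    unfolding mixed_norm_eq_iterated_norm[where x = 0] translate_def
    using iterated_norm_sum_shifts[of "\<lambda>x. ennreal (norm (f x))" R i N h
        "sorted_list_of_set UNIV" p 0] supp sep p
    by simp
qed

lemma measurable_translate [measurable (raw)]:
  fixes f :: "'a::euclidean_space \<Rightarrow> 'b::topological_space"
  assumes [measurable]: "f \<in> borel_measurable borel"
  shows "translate z f \<in> borel_measurable borel"
  unfolding translate_def by measurable

lemma mixed_norm_sum_translates_le:
  fixes f :: "real^'n^'m::{finite,linorder} \<Rightarrow> complex" and z :: "nat \<Rightarrow> real^'n^'m::{finite,linorder}"
  assumes [measurable]: "f \<in> borel_measurable borel" and p: "\<And>i. 1 \<le> p i"
  shows "mixed_norm p (\<lambda>x. \<Sum>j<N. translate (z j) f x)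
    \<le> (4 ^ CARD('m)) ^ N * (of_nat N * mixed_norm p f)"
  using mixed_norm_sum_le[of "\<lambda>j. translate (z j) f" p N] p
  by (simp add: mixed_norm_translate measurable_translate)

text \<open>With \<open>f\<close> split into its part \<open>c\<close> in the slab and the tail
  \<open>t\<close>, the exact formula applies to \<open>c\<close> and the crude bound to
  \<open>t\<close>.\<close>

lemma mixed_norm_sum_translates_upper:
  fixes f :: "real^'n^'m::{finite,linorder} \<Rightarrow> complex" and h :: "nat \<Rightarrow> real^'n"
    and i :: 'm
  assumes [measurable]: "f \<in> borel_measurable borel"
    and sep: "\<And>j k. j < N \<Longrightarrow> k < N \<Longrightarrow> j \<noteq> k \<Longrightarrow> 2 * R < norm (h j - h k)"
    and p: "\<And>i. 1 \<le> p i"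
  defines "t \<equiv> \<lambda>x. if norm (x $ i) \<le> R then 0 else f x"
  shows "mixed_norm p (\<lambda>x. \<Sum>j<N. translate (axis i (h j)) f x)
    \<le> 4 ^ CARD('m) * (ennreal (real N powr (1 / p i)) * mixed_norm p f
        + (4 ^ CARD('m)) ^ N * (of_nat N * mixed_norm p t))"
proof -
  define c where "c = (\<lambda>x. if norm (x $ i) \<le> R then f x else 0)"
  have [measurable]: "c \<in> borel_measurable borel" "t \<in> borel_measurable borel"
    unfolding c_def t_def by measurable
  have p': "0 < p i" for i
    using p[of i] by simp
  have "(\<lambda>x. \<Sum>j<N. translate (axis i (h j)) f x)
      = (\<lambda>x. (\<Sum>j<N. translate (axis i (h j)) c x) + (\<Sum>j<N. translate (axis i (h j)) t x))"
    unfolding sum.distrib[symmetric]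
    by (intro ext sum.cong) (auto simp: translate_def c_def t_def)
  then have "mixed_norm p (\<lambda>x. \<Sum>j<N. translate (axis i (h j)) f x)
      \<le> 4 ^ CARD('m) * (mixed_norm p (\<lambda>x. \<Sum>j<N. translate (axis i (h j)) c x)
        + mixed_norm p (\<lambda>x. \<Sum>j<N. translate (axis i (h j)) t x))"
    by (simp add: mixed_norm_add_le p)
  also have "mixed_norm p (\<lambda>x. \<Sum>j<N. translate (axis i (h j)) c x)
      = ennreal (real N powr (1 / p i)) * mixed_norm p c"
    by (rule mixed_norm_sum_translates[where R = R]) (use sep p' in \<open>auto simp: c_def\<close>)
  also have "mixed_norm p c \<le> mixed_norm p f"
    by (rule mixed_norm_mono) (auto simp: c_def p')
  also have "mixed_norm p (\<lambda>x. \<Sum>j<N. translate (axis i (h j)) t x)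
      \<le> (4 ^ CARD('m)) ^ N * (of_nat N * mixed_norm p t)"
    by (simp add: mixed_norm_sum_translates_le p)
  finally show ?thesis
    by (simp add: mult_left_mono add_mono)
qed

text \<open>The quasi-triangle inequality is used twice: to recover the translates of the slab part
  \<open>c\<close> from those of \<open>f\<close> and of the tail \<open>t\<close>, and to recover
  \<open>f\<close> from \<open>c\<close> and \<open>t\<close>.\<close>

lemma mixed_norm_sum_translates_lower:
  fixes f :: "real^'n^'m::{finite,linorder} \<Rightarrow> complex" and h :: "nat \<Rightarrow> real^'n"
    and i :: 'm
  assumes [measurable]: "f \<in> borel_measurable borel"
    and sep: "\<And>j k. j < N \<Longrightarrow> k < N \<Longrightarrow> j \<noteq> k \<Longrightarrow> 2 * R < norm (h j - h k)"
    and p: "\<And>i. 1 \<le> p i"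
  defines "t \<equiv> \<lambda>x. if norm (x $ i) \<le> R then 0 else f x"
  shows "ennreal (real N powr (1 / p i)) * mixed_norm p f
    \<le> 4 ^ CARD('m) * (4 ^ CARD('m) * (mixed_norm p (\<lambda>x. \<Sum>j<N. translate (axis i (h j)) f x)
          + (4 ^ CARD('m)) ^ N * (of_nat N * mixed_norm p t))
        + ennreal (real N powr (1 / p i)) * mixed_norm p t)"
proof -
  define c where "c = (\<lambda>x. if norm (x $ i) \<le> R then f x else 0)"
  define e where "e = ennreal (real N powr (1 / p i))"
  have [measurable]: "c \<in> borel_measurable borel" "t \<in> borel_measurable borel"
    unfolding c_def t_def by measurable
  have p': "0 < p i" for i
    using p[of i] by simp
  have f: "f = (\<lambda>x. c x + t x)"
    by (auto simp: c_def t_def)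
  have "(\<lambda>x. \<Sum>j<N. translate (axis i (h j)) c x)
      = (\<lambda>x. (\<Sum>j<N. translate (axis i (h j)) f x) + - (\<Sum>j<N. translate (axis i (h j)) t x))"
    unfolding add_uminus_conv_diff sum_subtractf[symmetric]
    by (intro ext sum.cong) (auto simp: translate_def c_def t_def)
  moreover have "mixed_norm p (\<lambda>x. \<Sum>j<N. translate (axis i (h j)) c x) = e * mixed_norm p c"
    unfolding e_def
    by (rule mixed_norm_sum_translates[where R = R]) (use sep p' in \<open>auto simp: c_def\<close>)
  ultimately have "e * mixed_norm p c = mixed_norm p
      (\<lambda>x. (\<Sum>j<N. translate (axis i (h j)) f x) + - (\<Sum>j<N. translate (axis i (h j)) t x))"
    by simp
  also have "\<dots> \<le> 4 ^ CARD('m) * (mixed_norm p (\<lambda>x. \<Sum>j<N. translate (axis i (h j)) f x)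
        + mixed_norm p (\<lambda>x. - (\<Sum>j<N. translate (axis i (h j)) t x)))"
    by (rule mixed_norm_add_le) (simp_all add: p)
  also have "mixed_norm p (\<lambda>x. - (\<Sum>j<N. translate (axis i (h j)) t x))
      \<le> (4 ^ CARD('m)) ^ N * (of_nat N * mixed_norm p t)"
    by (simp add: mixed_norm_uminus mixed_norm_sum_translates_le p)
  finally have c: "e * mixed_norm p c \<le> 4 ^ CARD('m) *
      (mixed_norm p (\<lambda>x. \<Sum>j<N. translate (axis i (h j)) f x)
          + (4 ^ CARD('m)) ^ N * (of_nat N * mixed_norm p t))"
    by (simp add: mult_left_mono add_mono)
  have "mixed_norm p f \<le> 4 ^ CARD('m) * (mixed_norm p c + mixed_norm p t)"
    by (subst (1) f, rule mixed_norm_add_le) (simp_all add: p)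
  then have "e * mixed_norm p f \<le> e * (4 ^ CARD('m) * (mixed_norm p c + mixed_norm p t))"
    by (rule mult_left_mono) simp
  also have "\<dots> = 4 ^ CARD('m) * (e * mixed_norm p c + e * mixed_norm p t)"
    by (simp add: algebra_simps)
  also have "\<dots> \<le> 4 ^ CARD('m) * (4 ^ CARD('m) *
      (mixed_norm p (\<lambda>x. \<Sum>j<N. translate (axis i (h j)) f x)
          + (4 ^ CARD('m)) ^ N * (of_nat N * mixed_norm p t)) + e * mixed_norm p t)"
    by (intro mult_left_mono add_mono c) simp_all
  finally show ?thesis
    by (simp add: e_def)
qed

section \<open>The operator on sums of translates\<close>

lemma mixed_Lp_zero:
  assumes "\<And>i. 1 \<le> p i"
  shows "(\<lambda>x. 0) \<in> mixed_Lp p"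
  using assms by (simp add: mixed_Lp_def mixed_norm_zero less_le_trans[OF zero_less_one])

lemma mixed_Lp_add:
  fixes f :: "real^'n^'m::{finite,linorder} \<Rightarrow> complex"
  assumes "f \<in> mixed_Lp p" "g \<in> mixed_Lp p" and p: "\<And>i. 1 \<le> p i"
  shows "(\<lambda>x. f x + g x) \<in> mixed_Lp p"
proof -
  have "4 ^ CARD('m) * (mixed_norm p f + mixed_norm p g) < top"
    using assms by (simp add: mixed_Lp_def ennreal_mult_less_top power_less_top_ennreal)
  then show ?thesis
    using assms mixed_norm_add_le[of f g p]
    by (auto simp: mixed_Lp_def intro: le_less_trans)
qed

lemma mixed_Lp_translate: "f \<in> mixed_Lp p \<Longrightarrow> translate z f \<in> mixed_Lp p"
  by (simp add: mixed_Lp_def mixed_norm_translate measurable_translate)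

lemma mixed_Lp_sum_translates:
  assumes "f \<in> mixed_Lp p" and "\<And>i. 1 \<le> p i"
  shows "(\<lambda>x. \<Sum>j<N::nat. translate (z j) f x) \<in> mixed_Lp p"
  by (induction N) (simp_all add: assms mixed_Lp_zero mixed_Lp_add mixed_Lp_translate)

lemma AE_sum_translates:
  fixes p :: "'m::{finite,linorder} \<Rightarrow> real"
    and T :: "(real^'n^'m::{finite,linorder} \<Rightarrow> complex) \<Rightarrow> real^'n^'m::{finite,linorder} \<Rightarrow> complex"
    and z :: "nat \<Rightarrow> real^'n^'m::{finite,linorder}"
  assumes T: "bounded_linear_mixed_Lp p q T" "commutes_with_translations p T"
    and f: "f \<in> mixed_Lp p" and p: "\<And>i. 1 \<le> p i"
  shows "AE x in lborel. T (\<lambda>x. \<Sum>j<N. translate (z j) f x) x = (\<Sum>j<N. translate (z j) (T f) x)"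
proof (induction N)
  case 0
  \<comment> \<open>The empty sum is \<open>0\<close>, and \<open>T\<close> maps it to
    \<open>0\<close> almost everywhere by homogeneity with the scalar \<open>0\<close>.\<close>
  have "AE x in lborel. T (\<lambda>y. 0 * f y) x = 0 * T f x"
    using T(1) f unfolding bounded_linear_mixed_Lp_def by blast
  then show ?case
    by simp
next
  case (Suc N)
  define s where "s = (\<lambda>x. \<Sum>j<N. translate (z j) f x)"
  have "s \<in> mixed_Lp p" "translate (z N) f \<in> mixed_Lp p"
    unfolding s_def using f p by (auto intro: mixed_Lp_sum_translates mixed_Lp_translate)
  then have "AE x in lborel. T (\<lambda>y. s y + translate (z N) f y) x = T s x + T (translate (z N) f) x"
    using T(1) unfolding bounded_linear_mixed_Lp_def by blast
  moreover have "AE x in lborel. T (translate (z N) f) x = translate (z N) (T f) x"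
    using T(2) f unfolding commutes_with_translations_def by blast
  ultimately show ?case
    using Suc.IH unfolding s_def[symmetric] sum.lessThan_Suc
    by eventually_elim (simp add: s_def)
qed

section \<open>Comparison of growth rates\<close>

lemma powr_exponent_le_if_bounded:
  fixes a M :: ennreal
  assumes bound: "\<And>N::nat. ennreal (real N powr \<alpha>) * a \<le> ennreal (real N powr \<beta>) * M"
    and "a \<noteq> 0" "M < top"
  shows "\<alpha> \<le> \<beta>"
proof (rule ccontr)
  assume "\<not> \<alpha> \<le> \<beta>"
  then have less: "\<beta> < \<alpha>"
    by simp
  obtain M' where M': "0 \<le> M'" "M = ennreal M'"
    using \<open>M < top\<close> by (cases M) auto
  \<comment> \<open>The case \<open>N = 1\<close> shows that \<open>a\<close> is finite, so the rest
    is about real numbers.\<close>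
  have "a \<le> M"
    using bound[of 1] by simp
  then obtain a' where a': "0 < a'" "a = ennreal a'"
    using \<open>a \<noteq> 0\<close> M' by (cases a) (auto simp: top_unique less_le)
  \<comment> \<open>Chosen so that \<open>b powr (\<alpha> - \<beta>)\<close> is
    \<open>M' / a' + 1\<close>; any \<open>N \<ge> b\<close> then violates the bound.\<close>
  define b where "b = (M' / a' + 1) powr (1 / (\<alpha> - \<beta>))"
  define N where "N = nat \<lceil>b\<rceil>"
  have "0 < M' / a' + 1"
    using M' a' by (simp add: add_nonneg_pos)
  then have "0 < b"
    unfolding b_def by simp
  moreover have "b \<le> real N"
    unfolding N_def by linarith
  ultimately have N: "0 < real N" "b \<le> real N" "0 < b"
    by auto
  have "M' / a' + 1 = b powr (\<alpha> - \<beta>)"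
    using less \<open>0 < M' / a' + 1\<close> by (simp add: b_def powr_powr)
  also have "\<dots> \<le> real N powr (\<alpha> - \<beta>)"
    using N less by (intro powr_mono2) auto
  finally have "M' < real N powr (\<alpha> - \<beta>) * a'"
    using a' by (simp add: field_simps)
  then have "real N powr \<beta> * M' < real N powr \<beta> * (real N powr (\<alpha> - \<beta>) * a')"
    using N by (intro mult_strict_left_mono) auto
  also have "\<dots> = real N powr \<alpha> * a'"
    using N by (simp add: powr_diff)
  finally show False
    using bound[of N] M' a' by (simp add: ennreal_mult'[symmetric] ennreal_le_iff)
qed

text \<open>Multiples of a unit vector with spacing \<open>2 * R + 1\<close> exceed the strict bound
  \<open>2 * R\<close> by a margin of at least 1.\<close>

lemma separated_shifts:
  fixes v :: "'a::real_normed_vector"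
  assumes "norm v = 1" "j \<noteq> k" "0 \<le> R"
  shows "2 * R < norm (((2 * R + 1) * real j) *\<^sub>R v - ((2 * R + 1) * real k) *\<^sub>R v)"
proof -
  have "1 \<le> \<bar>real j - real k\<bar>"
    using assms(2) by linarith
  then have "2 * R + 1 \<le> (2 * R + 1) * \<bar>real j - real k\<bar>"
    using assms(3) mult_left_mono[of 1 "\<bar>real j - real k\<bar>" "2 * R + 1"] by simp
  also have "\<dots> = norm (((2 * R + 1) * real j) *\<^sub>R v - ((2 * R + 1) * real k) *\<^sub>R v)"
    using assms by (simp add: scaleR_diff_left[symmetric] right_diff_distrib[symmetric] abs_mult)
  finally show ?thesis
    by simp
qed

text \<open>
  If the shifts are far apart, both sides of \<open>mixed_norm q (T F) \<le> C * mixed_norm p F\<close> are known up to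
  constants independent of \<open>N\<close> and up to tails, which vanish as the separation tends to infinity.
\<close>

lemma translation_invariant_growth:
  fixes p q :: "'m::{finite,linorder} \<Rightarrow> real"
    and T :: "(real^'n^'m::{finite,linorder} \<Rightarrow> complex) \<Rightarrow> real^'n^'m::{finite,linorder} \<Rightarrow> complex"
  assumes p: "\<And>i. 1 \<le> p i" and q: "\<And>i. 1 \<le> q i"
    and T: "bounded_linear_mixed_Lp p q T" "commutes_with_translations p T"
    and bound: "\<And>f. f \<in> mixed_Lp p \<Longrightarrow> mixed_norm q (T f) \<le> ennreal C * mixed_norm p f"
    and f: "f \<in> mixed_Lp p"
  shows "ennreal (real N powr (1 / q i)) * mixed_norm q (T f)
    \<le> ennreal (real N powr (1 / p i)) * ((4 ^ CARD('m)) ^ 3 * ennreal C * mixed_norm p f)"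
proof -
  define K :: ennreal where "K = 4 ^ CARD('m)"
  \<comment> \<open>Any unit vector would do; \<open>undefined\<close> names some unspecified
    coordinate.\<close>
  define v :: "real^'n" where "v = axis undefined 1"
  \<comment> \<open>The parameter \<open>n\<close> is at once the radius of the slab and, through
    the spacing \<open>2 * n + 1\<close>, the separation of the shifts.\<close>
  define h where "h = (\<lambda>n j. ((2 * real n + 1) * real j) *\<^sub>R v)"
  define F where "F = (\<lambda>n x. \<Sum>j<N. translate (axis i (h n j)) f x)"
  define G where "G = (\<lambda>n x. \<Sum>j<N. translate (axis i (h n j)) (T f) x)"
  define s where "s = (\<lambda>n. mixed_norm p (\<lambda>x. if norm (x $ i) \<le> real n then 0 else f x))"
  define t where "t = (\<lambda>n. mixed_norm q (\<lambda>x. if norm (x $ i) \<le> real n then 0 else T f x))"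
  define a where "a = ennreal (real N powr (1 / p i))"
  define b where "b = ennreal (real N powr (1 / q i))"
  have Tf: "T f \<in> mixed_Lp q"
    using T(1) f by (simp add: bounded_linear_mixed_Lp_def)
  have [measurable]: "f \<in> borel_measurable borel" "T f \<in> borel_measurable borel"
    using f Tf by (simp_all add: mixed_Lp_def)
  have pq: "0 < p i" "0 < q i" for i
    using p[of i] q[of i] by simp_all
  have sep: "2 * real n < norm (h n j - h n k)" if "j < N" "k < N" "j \<noteq> k" for n j k
    unfolding h_def using that by (intro separated_shifts) (simp_all add: v_def)
  have "K < top"
    \<comment> \<open>Finite factors are needed for the limit below, where
      \<open>ennreal_tendsto_cmult\<close> multiplies convergent sequences by constants.\<close>
    by (simp add: K_def power_less_top_ennreal)
  have F: "F n \<in> mixed_Lp p" for n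
    unfolding F_def by (rule mixed_Lp_sum_translates[OF f p])
  have "b * mixed_norm q (T f)
      \<le> K * (K * (ennreal C * (K * (a * mixed_norm p f + K ^ N * (of_nat N * s n)))
            + K ^ N * (of_nat N * t n)) + b * t n)" for n
  proof -
    have "b * mixed_norm q (T f)
        \<le> K * (K * (mixed_norm q (G n) + K ^ N * (of_nat N * t n)) + b * t n)"
      unfolding b_def G_def K_def t_def
      by (rule mixed_norm_sum_translates_lower[OF _ sep q]) simp_all
    \<comment> \<open>By linearity and commutation with translations, \<open>G n\<close> represents
      the same class as \<open>T (F n)\<close>; boundedness of \<open>T\<close> can now be applied
      to \<open>F n\<close>.\<close>
    also have "mixed_norm q (G n) = mixed_norm q (T (F n))"
    proof (rule mixed_norm_cong_AE)
      show "G n \<in> borel_measurable borel"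
        unfolding G_def by measurable
      have "T (F n) \<in> mixed_Lp q"
        using T(1) F by (simp add: bounded_linear_mixed_Lp_def)
      then show "T (F n) \<in> borel_measurable borel"
        by (simp add: mixed_Lp_def)
      show "AE x in lborel. G n x = T (F n) x"
        using AE_sum_translates[OF T f p, where N = N and z = "\<lambda>j. axis i (h n j)"]
        by (simp add: F_def G_def eq_commute)
    qed
    also have "mixed_norm q (T (F n)) \<le> ennreal C * mixed_norm p (F n)"
      by (rule bound[OF F])
    also have "mixed_norm p (F n) \<le> K * (a * mixed_norm p f + K ^ N * (of_nat N * s n))"
      unfolding a_def F_def K_def s_def
      by (rule mixed_norm_sum_translates_upper[OF _ sep p]) simp_all
    finally show ?thesis
      by (simp add: mult_left_mono add_mono)
  qed
  \<comment> \<open>Now \<open>n\<close> tends to infinity with \<open>N\<close> fixed, so both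
    tails vanish despite their large factors.\<close>
  moreover have "(\<lambda>n. K * (K * (ennreal C * (K * (a * mixed_norm p f + K ^ N * (of_nat N * s n)))
            + K ^ N * (of_nat N * t n)) + b * t n))
      \<longlonglongrightarrow> K * (K * (ennreal C * (K * (a * mixed_norm p f + K ^ N * (of_nat N * 0)))
            + K ^ N * (of_nat N * 0)) + b * 0)"
  proof -
    have "s \<longlonglongrightarrow> 0"
      unfolding s_def using f pq by (intro mixed_norm_tail_tendsto_0) (auto simp: mixed_Lp_def)
    moreover have "t \<longlonglongrightarrow> 0"
      unfolding t_def using Tf pq by (intro mixed_norm_tail_tendsto_0) (auto simp: mixed_Lp_def)
    ultimately show ?thesis
      using \<open>K < top\<close>
      by (intro ennreal_tendsto_cmult tendsto_add tendsto_const)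
        (simp_all add: power_less_top_ennreal of_nat_less_top a_def b_def)
  qed
  ultimately have "b * mixed_norm q (T f)
      \<le> K * (K * (ennreal C * (K * (a * mixed_norm p f + K ^ N * (of_nat N * 0)))
            + K ^ N * (of_nat N * 0)) + b * 0)"
    by (intro LIMSEQ_le_const) auto
  \<comment> \<open>Of the three factors \<open>K\<close>, two come from the lower bound for
    \<open>T f\<close> and one from the upper bound for \<open>f\<close>.\<close>
  also have "\<dots> = a * (K ^ 3 * ennreal C * mixed_norm p f)"
    by (simp add: power3_eq_cube mult_ac)
  finally show ?thesis
    by (simp add: a_def b_def K_def)
qed

text \<open>The zero operator is bounded and commutes with translations for all exponents;
  \<open>nonzero\<close> excludes it and provides an \<open>f\<close> for which
  \<open>mixed_norm q (T f)\<close> is positive.\<close>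

theorem theorem2p2:
  fixes p q :: "'m::{finite,linorder} \<Rightarrow> real"
    and T :: "(real ^ 'n ^ 'm::{finite,linorder} \<Rightarrow> complex) \<Rightarrow> real ^ 'n ^ 'm::{finite,linorder} \<Rightarrow> complex"
  assumes "\<And>i. 1 \<le> p i" and "\<And>i. 1 \<le> q i"
    and "bounded_linear_mixed_Lp p q T"
    and "commutes_with_translations p T"
    and nonzero: "\<exists>f \<in> mixed_Lp p. \<not> (AE x in lborel. T f x = 0)"
  shows "\<forall>i. q i \<ge> p i"
proof
  fix i
  obtain f where f: "f \<in> mixed_Lp p" "\<not> (AE x in lborel. T f x = 0)"
    using nonzero by blast
  obtain C :: real where C: "\<And>f. f \<in> mixed_Lp p \<Longrightarrow> mixed_norm q (T f) \<le> ennreal C * mixed_norm p f"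
    using assms(3) unfolding bounded_linear_mixed_Lp_def by blast
  have "T f \<in> mixed_Lp q"
    using assms(3) f(1) by (simp add: bounded_linear_mixed_Lp_def)
  then have "mixed_norm q (T f) \<noteq> 0"
    using f(2) mixed_norm_eq_0D[of "T f" q] by (auto simp: mixed_Lp_def)
  moreover have "(4 ^ CARD('m)) ^ 3 * ennreal C * mixed_norm p f < top"
    using f(1) by (simp add: mixed_Lp_def ennreal_mult_less_top power_less_top_ennreal)
  ultimately have "1 / q i \<le> 1 / p i"
    using translation_invariant_growth[OF assms(1-4) C f(1)]
    by (intro powr_exponent_le_if_bounded)
  moreover have "0 < p i" "0 < q i"
    using assms(1,2)[of i] by simp_all
  ultimately show "p i \<le> q i"
    by (simp add: field_simps)
qed

end
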